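(* Let $(\mathcal{G},f)$ be a system whose state at time $k$ is admissible, $x(k)\in\mathcal{O}$. If a token is injected at time $k$ in some node $i\in\mathcal{N}$, i.e. $v(k)=e_i$, then the injected token reaches its destination node $j\in\mathcal{N}$ following the (unconstrained) shortest path from $i$ to $j$, i.e. a path of minimum length $L$ among all paths from $i$ to $j$. If $j\in\mathcal{T}$ is a sink, then it is a closest sink to $i$, i.e. there is no $j'\in\mathcal{T}$ such that $L(p')<L(p)$, where $p$ (respectively $p'$) is the shortest path from $i$ to $j$ (respectively to $j'$); moreover, in this case, $x_i(k)=L(p)$.
   Context: **Network.** $\mathcal{G}=(\mathcal{N},\mathcal{A})$ is a finite directed network with nodes $\mathcal{N}=\{1,\dots,n\}$, arcs $\mathcal{A}\subseteq\mathcal{N}^2$, a finite integer cost $\gamma_{ij}\in\mathbb{Z}$ for each arc $(i,j)$, a set of source nodes $\mathcal{S}\subseteq\mathcal{N}$ and a set of sink nodes $\mathcal{T}\subseteq\mathcal{N}$ with $\mathcal{T}\cap\mathcal{S}=\emptyset$. A path is an ordered sequence of non-repeating nodes $h_1,\dots,h_r$ with $(h_s,h_{s+1})\in\mathcal{A}$; a circuit is such a sequence in which only the first and last nodes coincide. The length of a path (or circuit) $p$ is $L(p)=\sum_s\gamma_{h_sh_{s+1}}$. Put $\mathcal{N}_i=\{j:(i,j)\in\mathcal{A}\}\cup\{i\}$. **Standing assumptions.** $\mathcal{G}$ is weakly connected; from each source there is at least one path to a sink; there are no circuits of non-positive length; all costs satisfy $\gamma_{ij}\le\bar\gamma$; there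 are no paths of negative length between any pair of sinks. **State.** The state $x_i(k)$ of node $i$ is the number of tokens stopped (buffered) in $i$ at time $k$ (with negative-cost arcs, components may be negative, interpreted as virtual tokens); $x_i(k)=0$ for all $i\in\mathcal{T}$ and all $k$. The network state is $x=[x_1,\dots,x_n]^\top\in\mathbb{Z}^{|\mathcal{N}|}$. It is admissible if $x_i-x_j\le\gamma_{ij}$ for all $(i,j)\in\mathcal{A}$; $\mathcal{O}$ is the set of admissible states. $e_i$ is the $i$th canonical basis vector. **Dynamics (system $(\mathcal{G},f)$).** At each discrete time $k$ at most one token is injected; $v(k)=e_i$ if it is injected in node $i$, $v(k)=0$ if there is no injection. Between $k$ and $k+1$ the injected token moves instantaneously and alone, by the threshold policy: when the token is at a non-sink node $i$, it may traverse an arc $(i,j)\in\mathcal{A}$ only if $x_i+1-x_j>\gamma_{ij}$ (here $x_i$ does not count the moving token); if at least one outgoing arc satisfies this, the token is above-threshold and traverses one such arc (any choice rule is allowed); otherwise it is under-threshold and stops in $i$. A token reaching a sink leaves the network. The destination node of the token is the last node reached, where it stops (possibly a sink). If it stops in a non-sink node $j$ then $x(k+1)=x(k)+e_j$; if it leaves, $x(k+1)=x(k)$. Equivalently, with $u_{ij}(k)\in\{0,1\}$ indicating that arc $(i,j)$ is traversed, $x_i(k+1)=x_i(k)-\sum_{j\in\mathcal{N}_i}u_{ij}(k)+\sum_{j:i\in\mathcal{N}_j}u_{ji}(k)+v_i(k)$ for $i\notin\mathcal{T}$, where at most one token enters each node ($\sum_{j:i\in\mathcal{N}_j}u_{ji}+v_i\le1$),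 at most one leaves each node ($\sum_{j\in\mathcal{N}_i}u_{ij}\le1$), and $u_{ij}=1$ only if $x_i+\sum_{l:i\in\mathcal{N}_l}u_{li}+v_i-x_j>\gamma_{ij}$. Tokens have no memory of the traveled path. *)

theory Defs
  imports "Graph_Theory.Graph_Theory"
begin

text \<open>
  Walks are arc lists, as in the library; \<open>apath\<close> is a walk without repeated nodes (the empty arc
  list is the one-node path), \<open>cycle\<close> a nonempty closed walk in which only the end nodes coincide
  (loops included), and \<open>connected\<close> is weak connectivity.  The library function \<open>awalk_cost\<close> is
  real-valued, whereas here lengths are compared with integer token counts.
\<close>

definition walk_length :: "('v \<times> 'v \<Rightarrow> int) \<Rightarrow> ('v \<times> 'v) awalk \<Rightarrow> int" where
  "walk_length \<gamma> p = (\<Sum>a\<leftarrow>p. \<gamma> a)"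

definition shortest_path ::
  "'v pair_pre_digraph \<Rightarrow> ('v \<times> 'v \<Rightarrow> int) \<Rightarrow> 'v \<Rightarrow> ('v \<times> 'v) awalk \<Rightarrow> 'v \<Rightarrow> bool" where
  "shortest_path G \<gamma> i p j \<longleftrightarrow>
     pre_digraph.apath G i p j \<and>
     (\<forall>q. pre_digraph.apath G i q j \<longrightarrow> walk_length \<gamma> p \<le> walk_length \<gamma> q)"

locale network = pair_fin_digraph G
  for G :: "'v pair_pre_digraph"
    and \<gamma> :: "'v \<times> 'v \<Rightarrow> int"
    and sources :: "'v set"
    and sinks :: "'v set"
    and \<gamma>max :: int +
  assumes sources_subset: "sources \<subseteq> pverts G"
    and sinks_subset: "sinks \<subseteq> pverts G"
    and sinks_sources_disjoint: "sinks \<inter> sources = {}"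
    and weakly_connected: "connected G"
    and source_to_sink: "\<And>s. s \<in> sources \<Longrightarrow> \<exists>t\<in>sinks. \<exists>p. apath s p t"
    and circuits_positive: "\<And>c. cycle c \<Longrightarrow> 0 < walk_length \<gamma> c"
    and costs_bounded: "\<And>a. a \<in> parcs G \<Longrightarrow> \<gamma> a \<le> \<gamma>max"
    and sink_to_sink_nonneg:
      "\<And>s t p. s \<in> sinks \<Longrightarrow> t \<in> sinks \<Longrightarrow> apath s p t \<Longrightarrow> 0 \<le> walk_length \<gamma> p"

definition admissible_states ::
  "'v pair_pre_digraph \<Rightarrow> ('v \<times> 'v \<Rightarrow> int) \<Rightarrow> ('v \<Rightarrow> int) set" where
  "admissible_states G \<gamma> = {x. \<forall>(i, j) \<in> parcs G. x i - x j \<le> \<gamma> (i, j)}"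

definition canonical_vec :: "'v \<Rightarrow> 'v \<Rightarrow> int" where
  "canonical_vec i = (\<lambda>l. of_bool (l = i))"

definition may_traverse ::
  "'v pair_pre_digraph \<Rightarrow> ('v \<times> 'v \<Rightarrow> int) \<Rightarrow> 'v set \<Rightarrow> ('v \<Rightarrow> int) \<Rightarrow> 'v \<Rightarrow> 'v \<Rightarrow> bool" where
  "may_traverse G \<gamma> sinks x i j \<longleftrightarrow>
     i \<notin> sinks \<and> (i, j) \<in> parcs G \<and> x i + 1 - x j > \<gamma> (i, j)"

text \<open>The token halts at a node if the node is a sink or the token is under-threshold there.\<close>

definition halts_at ::
  "'v pair_pre_digraph \<Rightarrow> ('v \<times> 'v \<Rightarrow> int) \<Rightarrow> 'v set \<Rightarrow> ('v \<Rightarrow> int) \<Rightarrow> 'v \<Rightarrow> bool" where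
  "halts_at G \<gamma> sinks x i \<longleftrightarrow> (\<nexists>j. may_traverse G \<gamma> sinks x i j)"

text \<open>
  \<open>h s\<close> is the node occupied by the token after \<open>s\<close> elementary moves within one time step.
  The sequence is constant once the token has halted.  Every rule for choosing among the
  traversable arcs is allowed, and neither termination nor the absence of repeated nodes is built in.
\<close>

definition token_motion ::
  "'v pair_pre_digraph \<Rightarrow> ('v \<times> 'v \<Rightarrow> int) \<Rightarrow> 'v set \<Rightarrow> ('v \<Rightarrow> int) \<Rightarrow> 'v \<Rightarrow> (nat \<Rightarrow> 'v) \<Rightarrow> bool" where
  "token_motion G \<gamma> sinks x i h \<longleftrightarrow>
     h 0 = i \<and>
     (\<forall>s. if halts_at G \<gamma> sinks x (h s) then h (Suc s) = h s
          else may_traverse G \<gamma> sinks x (h s) (h (Suc s)))"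

text \<open>The token halts after finitely many moves, at destination \<open>j\<close>, having traversed exactly \<open>p\<close>.\<close>

definition reaches_destination ::
  "'v pair_pre_digraph \<Rightarrow> ('v \<times> 'v \<Rightarrow> int) \<Rightarrow> 'v set \<Rightarrow> ('v \<Rightarrow> int) \<Rightarrow> (nat \<Rightarrow> 'v) \<Rightarrow>
    ('v \<times> 'v) awalk \<Rightarrow> 'v \<Rightarrow> bool" where
  "reaches_destination G \<gamma> sinks x h p j \<longleftrightarrow>
     (\<exists>m. halts_at G \<gamma> sinks x (h m) \<and> (\<forall>s<m. \<not> halts_at G \<gamma> sinks x (h s)) \<and>
          j = h m \<and> p = map (\<lambda>s. (h s, h (Suc s))) [0..<m])"

text \<open>
  A run consists of the states \<open>x k\<close>, the injections \<open>v k\<close> and the motions \<open>h k\<close> of the injected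
  tokens (\<open>h k\<close> is irrelevant if nothing is injected at time \<open>k\<close>).  If a token never halted, the
  next state would be left unspecified; runs do not presuppose that tokens halt.
\<close>

definition system_run ::
  "'v pair_pre_digraph \<Rightarrow> ('v \<times> 'v \<Rightarrow> int) \<Rightarrow> 'v set \<Rightarrow>
    (nat \<Rightarrow> 'v \<Rightarrow> int) \<Rightarrow> (nat \<Rightarrow> 'v \<Rightarrow> int) \<Rightarrow> (nat \<Rightarrow> nat \<Rightarrow> 'v) \<Rightarrow> bool" where
  "system_run G \<gamma> sinks x v h \<longleftrightarrow>
     (\<forall>k. (\<forall>t\<in>sinks. x k t = 0) \<and>
       (v k = (\<lambda>_. 0) \<and> (\<forall>l\<in>pverts G. x (Suc k) l = x k l) \<or>
        (\<exists>i\<in>pverts G. v k = canonical_vec i \<and>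
           token_motion G \<gamma> sinks (x k) i (h k) \<and>
           (\<forall>p j. reaches_destination G \<gamma> sinks (x k) (h k) p j \<longrightarrow>
             (\<forall>l\<in>pverts G. x (Suc k) l =
                x k l + (if j \<in> sinks then 0 else canonical_vec j l))))))"

end

theory Submission
  imports Defs
begin

text \<open>
  In an admissible state the threshold policy lets the token traverse only tight arcs, those with
  \<open>\<gamma>\<^sub>i\<^sub>j = x\<^sub>i - x\<^sub>j\<close>.  The length of the traversed walk from \<open>i\<close> to \<open>j\<close> therefore telescopes to
  \<open>x\<^sub>i - x\<^sub>j\<close>, which is a lower bound for every walk from \<open>i\<close> to \<open>j\<close>.  A repeated node would close a
  circuit of length zero, so the walk is a path and, the network being finite, it ends.
  Sinks have \<open>x\<^sub>j = 0\<close>, so the bound \<open>x\<^sub>i\<close> is the same for all of them.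
\<close>

context network
begin

text \<open>The state acts as a potential: the admissibility inequalities of the arcs telescope
  along the walk. This is the bound applied to every competing path.\<close>

lemma admissible_diff_le_walk_length:
  assumes "x \<in> admissible_states G \<gamma>" "awalk u p w"
  shows "x u - x w \<le> walk_length \<gamma> p"
  using assms(2)
proof (induction p arbitrary: u)
  case Nil
  then show ?case by (simp add: walk_length_def awalk_Nil_iff)
next
  case (Cons a p)
  obtain i j where a: "a = (i, j)" by (cases a)
  from Cons.prems have arc: "(i, j) \<in> parcs G" and u: "u = i" and w: "awalk j p w"
    by (auto simp: a awalk_Cons_iff)
  have "x i - x j \<le> \<gamma> (i, j)"
    using assms(1) arc by (auto simp: admissible_states_def)
  with Cons.IH[OF w] show ?case
    by (simp add: walk_length_def a u)
qed

text \<open>By integrality, \<open>x\<^sub>i + 1 - x\<^sub>j > \<gamma>\<^sub>i\<^sub>j\<close> is the reverse of the admissibility inequality.\<close>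

lemma may_traverse_tight:
  assumes "x \<in> admissible_states G \<gamma>" "may_traverse G \<gamma> sinks x i j"
  shows "\<gamma> (i, j) = x i - x j"
proof -
  have "x i - x j \<le> \<gamma> (i, j)"
    using assms by (auto simp: admissible_states_def may_traverse_def)
  with assms(2) show ?thesis
    by (auto simp: may_traverse_def)
qed

lemma walk_length_segment:
  assumes "a \<le> b" "\<And>s. a \<le> s \<Longrightarrow> s < b \<Longrightarrow> \<gamma> (h s, h (Suc s)) = x (h s) - x (h (Suc s))"
  shows "walk_length \<gamma> (map (\<lambda>s. (h s, h (Suc s))) [a..<b]) = x (h a) - x (h b)"
  using assms by (induction b rule: dec_induct) (auto simp: walk_length_def)

text \<open>The node list is carried along because both \<open>cycle\<close> and
  \<open>apath\<close> ask for distinctness of visited nodes.\<close>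

lemma awalk_segment:
  assumes "a \<le> b" "h a \<in> pverts G" "\<And>s. a \<le> s \<Longrightarrow> s < b \<Longrightarrow> (h s, h (Suc s)) \<in> parcs G"
  shows "awalk (h a) (map (\<lambda>s. (h s, h (Suc s))) [a..<b]) (h b)
    \<and> awalk_verts (h a) (map (\<lambda>s. (h s, h (Suc s))) [a..<b]) = map h [a..<Suc b]"
  using assms
proof (induction a rule: inc_induct)
  case base
  then show ?case by (simp add: awalk_Nil_iff)
next
  case (step a)
  have arc: "(h a, h (Suc a)) \<in> parcs G" using step by simp
  have "h (Suc a) \<in> pverts G" using arc by (auto dest: in_arcsD2)
  moreover have "[a..<b] = a # [Suc a..<b]" "[a..<Suc b] = a # [Suc a..<Suc b]"
    using step.hyps by (simp_all add: upt_rec)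
  ultimately show ?case
    using step arc by (auto simp: awalk_Cons_iff)
qed

text \<open>Up to the first return to a visited node, the traversed arcs form a circuit of length zero.\<close>

lemma tight_walk_inj_on:
  assumes "h 0 \<in> pverts G"
    and arc: "\<And>s. s < m \<Longrightarrow> (h s, h (Suc s)) \<in> parcs G"
    and tight: "\<And>s. s < m \<Longrightarrow> \<gamma> (h s, h (Suc s)) = x (h s) - x (h (Suc s))"
  shows "inj_on h {..m}"
proof (rule ccontr)
  assume "\<not> inj_on h {..m}"
  then have "\<exists>b. b \<le> m \<and> (\<exists>a<b. h a = h b)"
    unfolding inj_on_def by (metis atMost_iff nat_neq_iff)
  \<comment> \<open>Taking the earliest return \<open>b\<close> leaves no repetition strictly
    between \<open>a\<close> and \<open>b\<close>.\<close>
  then obtain b where b: "b \<le> m" "\<exists>a<b. h a = h b"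
    and least: "\<And>c. c < b \<Longrightarrow> \<not> (c \<le> m \<and> (\<exists>a<c. h a = h c))"
    using exists_least_iff[of "\<lambda>b. b \<le> m \<and> (\<exists>a<b. h a = h b)"] by blast
  then obtain a where a: "a < b" "h a = h b" by blast
  let ?c = "map (\<lambda>s. (h s, h (Suc s))) [a..<b]"
  have "h a \<in> pverts G"
    using arc[of a] a b by (auto dest: in_arcsD1)
  then have walk: "awalk (h a) ?c (h b)" "awalk_verts (h a) ?c = map h [a..<Suc b]"
    using awalk_segment[of a b h] arc a b by auto
  have "inj_on h {Suc a..b}"
  proof (rule linorder_inj_onI')
    fix s t assume "s \<in> {Suc a..b}" "t \<in> {Suc a..b}" "s < t"
    \<comment> \<open>If \<open>t < b\<close>, minimality of \<open>b\<close> applies to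
      \<open>t\<close>. If \<open>t = b\<close>, a coincidence would give \<open>h s = h a\<close>,
      making \<open>s\<close> an earlier return.\<close>
    then show "h s \<noteq> h t"
      using least[of t] least[of s] a b by (cases "t = b") auto
  qed
  then have "distinct (map h [Suc a..<Suc b])"
    by (simp add: distinct_map atLeastLessThanSuc_atLeastAtMost del: upt_Suc)
  \<comment> \<open>\<open>cycle\<close> tests distinctness only on the tail of the node list, as
    the two ends coincide.\<close>
  moreover have "tl (map h [a..<Suc b]) = map h [Suc a..<Suc b]"
    using a by (simp add: map_tl[symmetric] tl_upt del: upt_Suc)
  ultimately have "cycle ?c"
    using walk a unfolding cycle_def by auto
  moreover have "walk_length \<gamma> ?c = 0"
    using walk_length_segment[of a b h x] tight a b by simp
  ultimately show False
    using circuits_positive by fastforce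
qed

text \<open>Halting is derived here: all moves before a halt are tight, hence never revisit a node,
  and there are finitely many nodes.\<close>

lemma token_reaches_destination:
  assumes adm: "x \<in> admissible_states G \<gamma>"
    and i: "i \<in> pverts G"
    and motion: "token_motion G \<gamma> sinks x i h"
  obtains p j where "reaches_destination G \<gamma> sinks x h p j" "apath i p j"
    "walk_length \<gamma> p = x i - x j"
proof -
  have h0: "h 0 = i"
    using motion by (simp add: token_motion_def)
  have step: "may_traverse G \<gamma> sinks x (h s) (h (Suc s))" if "\<not> halts_at G \<gamma> sinks x (h s)" for s
    using motion that unfolding token_motion_def by metis
  have arc: "(h s, h (Suc s)) \<in> parcs G" if "\<not> halts_at G \<gamma> sinks x (h s)" for s
    using step[OF that] by (simp add: may_traverse_def)
  have tight: "\<gamma> (h s, h (Suc s)) = x (h s) - x (h (Suc s))" if "\<not> halts_at G \<gamma> sinks x (h s)" for s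
    using may_traverse_tight[OF adm step[OF that]] .
  have inj: "inj_on h {..m}" if "\<And>s. s < m \<Longrightarrow> \<not> halts_at G \<gamma> sinks x (h s)" for m
    using tight_walk_inj_on[of h m x] that arc tight h0 i by blast
  have "\<exists>m. halts_at G \<gamma> sinks x (h m)"
  proof (rule ccontr)
    assume *: "\<nexists>m. halts_at G \<gamma> sinks x (h m)"
    \<comment> \<open>Any two times lie in the initial segment ending at the later one.\<close>
    then have "inj h"
      using inj by (metis UNIV_I atMost_iff inj_on_def linorder_le_cases)
    moreover have "range h \<subseteq> pverts G"
      using arc * by (auto dest: in_arcsD1)
    ultimately show False
      using finite_subset[OF _ pair_finite_verts] finite_imageD infinite_UNIV_nat by blast
  qed
  then obtain m where m: "halts_at G \<gamma> sinks x (h m)"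
    and before: "\<And>s. s < m \<Longrightarrow> \<not> halts_at G \<gamma> sinks x (h s)"
    using exists_least_iff[of "\<lambda>m. halts_at G \<gamma> sinks x (h m)"] by blast
  let ?p = "map (\<lambda>s. (h s, h (Suc s))) [0..<m]"
  have "awalk i ?p (h m)" "awalk_verts i ?p = map h [0..<Suc m]"
    using awalk_segment[of 0 m h] arc before h0 i by auto
  moreover have "distinct (map h [0..<Suc m])"
    using inj[of m] before
    by (simp add: distinct_map atLeast0LessThan lessThan_Suc_atMost del: upt_Suc)
  ultimately have "apath i ?p (h m)"
    by (simp add: apath_def)
  moreover have "walk_length \<gamma> ?p = x i - x (h m)"
    using walk_length_segment[of 0 m h x] tight before h0 by simp
  moreover have "reaches_destination G \<gamma> sinks x h ?p (h m)"
    using m before unfolding reaches_destination_def by blast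
  ultimately show thesis
    using that by blast
qed

end

theorem theorem4:
  fixes G :: "'v pair_pre_digraph"
    and \<gamma> :: "'v \<times> 'v \<Rightarrow> int"
    and sources sinks :: "'v set"
    and \<gamma>max :: int
    and x v :: "nat \<Rightarrow> 'v \<Rightarrow> int"
    and h :: "nat \<Rightarrow> nat \<Rightarrow> 'v"
    and k :: nat and i :: 'v
  assumes "network G \<gamma> sources sinks \<gamma>max"
    and "system_run G \<gamma> sinks x v h"
    and "x k \<in> admissible_states G \<gamma>"
    and "i \<in> pverts G"
    and "v k = canonical_vec i"
  shows "\<exists>p. \<exists>j\<in>pverts G.
           reaches_destination G \<gamma> sinks (x k) (h k) p j \<and>
           shortest_path G \<gamma> i p j \<and>
           (j \<in> sinks \<longrightarrow>
              \<not> (\<exists>j'\<in>sinks. \<exists>p'. shortest_path G \<gamma> i p' j' \<and>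
                    walk_length \<gamma> p' < walk_length \<gamma> p) \<and>
              x k i = walk_length \<gamma> p)"
proof -
  interpret network G \<gamma> sources sinks \<gamma>max by fact
  have sink0: "x k t = 0" if "t \<in> sinks" for t
    using assms(2) that by (simp add: system_run_def)
  have "v k \<noteq> (\<lambda>_. 0)"
    using assms(5) by (auto simp: canonical_vec_def fun_eq_iff)
  then obtain i' where "v k = canonical_vec i'" "token_motion G \<gamma> sinks (x k) i' (h k)"
    using assms(2) unfolding system_run_def by metis
  moreover from this have "canonical_vec i' i = canonical_vec i i"
    using assms(5) by simp
  \<comment> \<open>At \<open>i\<close> the right-hand vector has entry 1, the left-hand one only if
    \<open>i' = i\<close>.\<close>
  then have "i' = i"
    by (simp add: canonical_vec_def of_bool_def split: if_splits)
  ultimately have "token_motion G \<gamma> sinks (x k) i (h k)" by simp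
  from token_reaches_destination[OF assms(3,4) this] obtain p j
    where p: "reaches_destination G \<gamma> sinks (x k) (h k) p j" "apath i p j"
      "walk_length \<gamma> p = x k i - x k j" .
  have lower: "x k i - x k j' \<le> walk_length \<gamma> q" if "apath i q j'" for q j'
    using admissible_diff_le_walk_length[OF assms(3)] that by (simp add: apath_def)
  have "j \<in> pverts G"
    using p(2) by (auto simp: apath_def)
  moreover have "shortest_path G \<gamma> i p j"
    using p lower by (auto simp: shortest_path_def)
  moreover have "\<not> walk_length \<gamma> p' < walk_length \<gamma> p"
    if "j \<in> sinks" "j' \<in> sinks" "shortest_path G \<gamma> i p' j'" for p' j'
    using lower[of p' j'] p(3) sink0 that by (simp add: shortest_path_def)
  ultimately show ?thesis
    using p sink0 by fastforce
qed

end
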